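(* Let $K\subseteq\mathbb R^d$ be a closed convex set, and let $\{v_1,\dots,v_N\}$ be an isometric tight frame in $\mathbb R^d$ with vectors of length $\ell$ such that $\frac1{\ell^2}v_iv_i^*(K)\subseteq K$ for every $i$. Then $\mathcal W^{\max}(K)\subseteq d\,\mathcal W^{\min}(K)$.
   Context: A finite set $\{v_1,\dots,v_N\}$ of distinct vectors in $\mathbb R^d$ is a tight frame if there is $\sigma>0$ with $\sum_i|\langle x,v_i\rangle|^2=\sigma\|x\|^2$ for all $x\in\mathbb R^d$ (equivalently $\sum_iv_iv_i^*=\sigma I$); it is isometric if all $v_i$ have the same length $\ell>0$. $(M_n)^d_{sa}$ is the set of $d$-tuples of self-adjoint $n\times n$ complex matrices. For a closed convex $K\subseteq\mathbb R^d$: $\mathcal W^{\min}(K)=\bigcup_n\mathcal W^{\min}_n(K)$, where $\mathcal W^{\min}_n(K)$ is the set of $X\in(M_n)^d_{sa}$ for which there are a tuple $N$ of commuting normal operators on a Hilbert space $L$ with joint spectrum $\sigma(N)\subseteq K$ and an isometry $V:\mathbb C^n\to L$ with $X_i=V^*N_iV$ for all $i$; and $\mathcal W^{\max}(K)=\bigcup_n\mathcal W^{\max}_n(K)$, where $\mathcal W^{\max}_n(K)$ is the set of $X\in(M_n)^d_{sa}$ such that $\sum_i\alpha_iX_i\le aI_n$ whenever $\alpha\in\mathbb R^d$, $a\in\mathbb R$ satisfy $\sum_i\alpha_ix_i\le a$ for all $x\in K$. $c\,\mathcal S=\{cX:X\in\mathcal S\}$; inclusion means inclusion at every level $n$. 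*)

theory Defs
  imports "HOL-Analysis.Analysis" "Jordan_Normal_Form.VS_Connect"
    "Jordan_Normal_Form.Schur_Decomposition"
begin

hide_const (open) Matrix.vec Matrix.mat Matrix.row Matrix.col Matrix.transpose_mat
no_notation Matrix.vec_index (infixl \<open>$\<close> 100)
no_notation Matrix.scalar_prod (infix \<open>\<bullet>\<close> 70)

text \<open>Frames in \<open>\<real>\<^sup>d\<close>, where \<open>d = CARD('d)\<close>.\<close>

definition tight_frame :: "(real ^ 'd) set \<Rightarrow> bool" where
  "tight_frame F \<longleftrightarrow>
     finite F \<and> (\<exists>\<sigma>>0. \<forall>x. (\<Sum>v\<in>F. \<bar>inner x v\<bar>\<^sup>2) = \<sigma> * (norm x)\<^sup>2)"

definition isometric_tight_frame :: "(real ^ 'd) set \<Rightarrow> real \<Rightarrow> bool" where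
  "isometric_tight_frame F l \<longleftrightarrow> tight_frame F \<and> l > 0 \<and> (\<forall>v\<in>F. norm v = l)"

text \<open>The rank-one matrix \<open>v v\<^sup>*\<close>.\<close>

definition outer_self :: "real ^ 'd \<Rightarrow> real ^ 'd ^ 'd" where
  "outer_self v = (\<chi> i j. v $ i * v $ j)"

text \<open>
  Complex Hilbert spaces are modelled on an explicit carrier, as vector spaces over
  \<^const>\<open>class_ring\<close> (the field of complex numbers) with a form that is linear in its
  first argument. The record fields \<open>mult\<close> and \<open>one\<close> that modules inherit from rings
  play no role.
\<close>

record 'h hilbert = "(complex, 'h) module" +
  cinner :: "'h \<Rightarrow> 'h \<Rightarrow> complex"

definition hnorm :: "('h, 'm) hilbert_scheme \<Rightarrow> 'h \<Rightarrow> real" where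
  "hnorm H x = sqrt (Re (cinner H x x))"

locale hilbert_space = vectorspace "class_ring :: complex ring" H
  for H :: "('h, 'm) hilbert_scheme" (structure) +
  assumes cinner_add_left:
      "\<lbrakk>x \<in> carrier H; y \<in> carrier H; z \<in> carrier H\<rbrakk>
        \<Longrightarrow> cinner H (x \<oplus> y) z = cinner H x z + cinner H y z"
    and cinner_smult_left:
      "\<lbrakk>x \<in> carrier H; z \<in> carrier H\<rbrakk> \<Longrightarrow> cinner H (a \<odot>\<^bsub>H\<^esub> x) z = a * cinner H x z"
    and cinner_cnj:
      "\<lbrakk>x \<in> carrier H; y \<in> carrier H\<rbrakk> \<Longrightarrow> cinner H y x = cnj (cinner H x y)"
    and cinner_nonneg: "x \<in> carrier H \<Longrightarrow> 0 \<le> Re (cinner H x x)"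
    and cinner_definite: "\<lbrakk>x \<in> carrier H; cinner H x x = 0\<rbrakk> \<Longrightarrow> x = \<zero>"
    and complete:
      "\<lbrakk>\<And>k :: nat. s k \<in> carrier H;
        \<And>e. e > 0 \<Longrightarrow> \<exists>M. \<forall>m\<ge>M. \<forall>k\<ge>M. hnorm H (s m \<ominus> s k) < e\<rbrakk>
        \<Longrightarrow> \<exists>x\<in>carrier H. (\<lambda>k. hnorm H (s k \<ominus> x)) \<longlonglongrightarrow> 0"

definition cvec_space :: "nat \<Rightarrow> complex vec hilbert" where
  "cvec_space n =
     module.extend (module_vec TYPE(complex) n) (hilbert.fields (\<lambda>x y. x \<bullet>c y))"

text \<open>
  Bounded operators are extensional outside the carrier, so that equality of
  operators is equality in HOL.
\<close>

definition bounded_ops ::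
  "('g, 'm) hilbert_scheme \<Rightarrow> ('h, 'k) hilbert_scheme \<Rightarrow> ('g \<Rightarrow> 'h) set" where
  "bounded_ops G H =
     {T \<in> extensional (carrier G). T \<in> module_hom (class_ring :: complex ring) G H \<and>
        (\<exists>c. \<forall>x\<in>carrier G. hnorm H (T x) \<le> c * hnorm G x)}"

definition hadjoint ::
  "('g, 'm) hilbert_scheme \<Rightarrow> ('h, 'k) hilbert_scheme \<Rightarrow> ('g \<Rightarrow> 'h) \<Rightarrow> ('h \<Rightarrow> 'g)" where
  "hadjoint G H T = (THE S. S \<in> bounded_ops H G \<and>
     (\<forall>x\<in>carrier G. \<forall>y\<in>carrier H. cinner H (T x) y = cinner G x (S y)))"

definition hisometry ::
  "('g, 'm) hilbert_scheme \<Rightarrow> ('h, 'k) hilbert_scheme \<Rightarrow> ('g \<Rightarrow> 'h) \<Rightarrow> bool" where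
  "hisometry G H V \<longleftrightarrow>
     V \<in> bounded_ops G H \<and> (\<forall>x\<in>carrier G. hnorm H (V x) = hnorm G x)"

definition op_id :: "('h, 'm) hilbert_scheme \<Rightarrow> 'h \<Rightarrow> 'h" where
  "op_id H = (\<lambda>x\<in>carrier H. x)"

definition op_add :: "('h, 'm) hilbert_scheme \<Rightarrow> ('h \<Rightarrow> 'h) \<Rightarrow> ('h \<Rightarrow> 'h) \<Rightarrow> ('h \<Rightarrow> 'h)" where
  "op_add H S T = (\<lambda>x\<in>carrier H. S x \<oplus>\<^bsub>H\<^esub> T x)"

definition op_diff :: "('h, 'm) hilbert_scheme \<Rightarrow> ('h \<Rightarrow> 'h) \<Rightarrow> ('h \<Rightarrow> 'h) \<Rightarrow> ('h \<Rightarrow> 'h)" where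
  "op_diff H S T = (\<lambda>x\<in>carrier H. S x \<ominus>\<^bsub>H\<^esub> T x)"

definition op_smult :: "('h, 'm) hilbert_scheme \<Rightarrow> complex \<Rightarrow> ('h \<Rightarrow> 'h) \<Rightarrow> ('h \<Rightarrow> 'h)" where
  "op_smult H a T = (\<lambda>x\<in>carrier H. a \<odot>\<^bsub>H\<^esub> T x)"

definition op_mult :: "('h, 'm) hilbert_scheme \<Rightarrow> ('h \<Rightarrow> 'h) \<Rightarrow> ('h \<Rightarrow> 'h) \<Rightarrow> ('h \<Rightarrow> 'h)" where
  "op_mult H S T = compose (carrier H) S T"

definition op_norm :: "('h, 'm) hilbert_scheme \<Rightarrow> ('h \<Rightarrow> 'h) \<Rightarrow> real" where
  "op_norm H T = Inf {c. 0 \<le> c \<and> (\<forall>x\<in>carrier H. hnorm H (T x) \<le> c * hnorm H x)}"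

definition normal_op :: "('h, 'm) hilbert_scheme \<Rightarrow> ('h \<Rightarrow> 'h) \<Rightarrow> bool" where
  "normal_op H T \<longleftrightarrow> T \<in> bounded_ops H H \<and>
     op_mult H T (hadjoint H H T) = op_mult H (hadjoint H H T) T"

definition unital_cstar_subalgebra ::
  "('h, 'm) hilbert_scheme \<Rightarrow> ('h \<Rightarrow> 'h) set \<Rightarrow> bool" where
  "unital_cstar_subalgebra H A \<longleftrightarrow>
     A \<subseteq> bounded_ops H H \<and>
     op_id H \<in> A \<and>
     (\<forall>S\<in>A. \<forall>T\<in>A. op_add H S T \<in> A \<and> op_mult H S T \<in> A) \<and>
     (\<forall>a. \<forall>T\<in>A. op_smult H a T \<in> A) \<and>
     (\<forall>T\<in>A. hadjoint H H T \<in> A) \<and>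
     (\<forall>S\<in>bounded_ops H H.
        (\<forall>e>0. \<exists>T\<in>A. op_norm H (op_diff H S T) < e) \<longrightarrow> S \<in> A)"

definition cstar_generated ::
  "('h, 'm) hilbert_scheme \<Rightarrow> ('d \<Rightarrow> 'h \<Rightarrow> 'h) \<Rightarrow> ('h \<Rightarrow> 'h) set" where
  "cstar_generated H N = \<Inter> {A. unital_cstar_subalgebra H A \<and> range N \<subseteq> A}"

text \<open>
  Multiplicative linear functionals; for these, being nonzero and being unital are the
  same. Only the values on \<open>A\<close> matter.
\<close>

definition character_on ::
  "('h, 'm) hilbert_scheme \<Rightarrow> ('h \<Rightarrow> 'h) set \<Rightarrow> (('h \<Rightarrow> 'h) \<Rightarrow> complex) \<Rightarrow> bool" where
  "character_on H A \<phi> \<longleftrightarrow>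
     \<phi> (op_id H) = 1 \<and>
     (\<forall>S\<in>A. \<forall>T\<in>A. \<phi> (op_add H S T) = \<phi> S + \<phi> T \<and> \<phi> (op_mult H S T) = \<phi> S * \<phi> T) \<and>
     (\<forall>a. \<forall>T\<in>A. \<phi> (op_smult H a T) = a * \<phi> T)"

text \<open>
  The joint spectrum of commuting normal operators is the image of the character space of
  the unital C*-algebra they generate under \<open>\<phi> \<mapsto> (\<phi> N\<^sub>i)\<^sub>i\<close>.
\<close>

definition joint_spectrum ::
  "('h, 'm) hilbert_scheme \<Rightarrow> ('d \<Rightarrow> 'h \<Rightarrow> 'h) \<Rightarrow> (complex ^ 'd) set" where
  "joint_spectrum H N =
     {(\<chi> i. \<phi> (N i)) |\<phi>. character_on H (cstar_generated H N) \<phi>}"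

definition complexify :: "real ^ 'd \<Rightarrow> complex ^ 'd" where
  "complexify x = (\<chi> i. complex_of_real (x $ i))"

text \<open>Tuples of matrices are indexed by \<open>'d\<close>.\<close>

definition sa_tuples :: "nat \<Rightarrow> ('d \<Rightarrow> complex mat) set" where
  "sa_tuples n = {X. \<forall>i. X i \<in> carrier_mat n n \<and> mat_adjoint (X i) = X i}"

text \<open>
  The order on \<^typ>\<open>complex\<close> makes \<open>0 \<le> z\<close> say that \<open>z\<close> is real and nonnegative, so this
  is the usual order on self-adjoint matrices.
\<close>

definition mat_le :: "nat \<Rightarrow> complex mat \<Rightarrow> complex mat \<Rightarrow> bool" where
  "mat_le n A B \<longleftrightarrow> (\<forall>x\<in>carrier_vec n. 0 \<le> ((B - A) *\<^sub>v x) \<bullet>c x)"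

text \<open>
  Matrices of unspecified size have no \<^const>\<open>sum\<close>, so \<open>\<Sum>\<^sub>i \<alpha>\<^sub>i X\<^sub>i\<close> is written entrywise.
\<close>

definition lin_comb_mat :: "nat \<Rightarrow> real ^ 'd \<Rightarrow> ('d \<Rightarrow> complex mat) \<Rightarrow> complex mat" where
  "lin_comb_mat n \<alpha> X =
     Matrix.mat n n (\<lambda>rc. \<Sum>i\<in>UNIV. complex_of_real (\<alpha> $ i) * (X i $$ rc))"

definition Wmax_level :: "nat \<Rightarrow> (real ^ 'd) set \<Rightarrow> ('d \<Rightarrow> complex mat) set" where
  "Wmax_level n K =
     {X \<in> sa_tuples n. \<forall>\<alpha> a. (\<forall>x\<in>K. (\<Sum>i\<in>UNIV. \<alpha> $ i * x $ i) \<le> a) \<longrightarrow>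
        mat_le n (lin_comb_mat n \<alpha> X) (complex_of_real a \<cdot>\<^sub>m 1\<^sub>m n)}"

text \<open>
  HOL cannot quantify existentially over types, so the Hilbert space \<open>L\<close> ranges over all
  Hilbert spaces whose carrier is a subset of \<^typ>\<open>nat \<Rightarrow> complex\<close>. Up to unitary equivalence
  these include every separable Hilbert space (as \<open>\<ell>\<^sup>2\<close> or \<open>\<complex>\<^sup>m\<close>), and no other spaces are
  needed: \<open>L\<close> can be replaced by the closed span of \<open>C*(N) V \<complex>\<^sup>n\<close>, which is separable and
  reduces \<open>N\<close>, and the restriction of \<open>N\<close> to it has joint spectrum contained in \<open>\<sigma>(N)\<close>.
\<close>

definition Wmin_level :: "nat \<Rightarrow> (real ^ 'd) set \<Rightarrow> ('d \<Rightarrow> complex mat) set" where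
  "Wmin_level n K =
     {X \<in> sa_tuples n. \<exists>(L :: (nat \<Rightarrow> complex) hilbert) N V.
        hilbert_space L \<and>
        (\<forall>i. normal_op L (N i)) \<and>
        (\<forall>i j. op_mult L (N i) (N j) = op_mult L (N j) (N i)) \<and>
        joint_spectrum L N \<subseteq> complexify ` K \<and>
        hisometry (cvec_space n) L V \<and>
        (\<forall>i. \<forall>x\<in>carrier_vec n. X i *\<^sub>v x = hadjoint (cvec_space n) L V (N i (V x)))}"

text \<open>
  Since \<open>'d\<close> is nonempty, a tuple determines its level, so inclusion between such unions is
  inclusion at every level.
\<close>

definition Wmax :: "(real ^ 'd) set \<Rightarrow> ('d \<Rightarrow> complex mat) set" where
  "Wmax K = (\<Union>n\<in>{1..}. Wmax_level n K)"

definition Wmin :: "(real ^ 'd) set \<Rightarrow> ('d \<Rightarrow> complex mat) set" where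
  "Wmin K = (\<Union>n\<in>{1..}. Wmin_level n K)"

definition scale_tuples :: "real \<Rightarrow> ('d \<Rightarrow> complex mat) set \<Rightarrow> ('d \<Rightarrow> complex mat) set" where
  "scale_tuples c S = (\<lambda>X i. complex_of_real c \<cdot>\<^sub>m X i) ` S"

end

theory Submission
  imports Defs
begin

text \<open>
  For \<open>X\<close> in the maximal set of level \<open>n\<close> and \<open>v\<close> in the frame, put \<open>Y\<^sub>v = \<Sum>\<^sub>i v\<^sub>i X\<^sub>i\<close>. The frame
  identity gives \<open>X = d * average\<^sub>v (v/l\<^sup>2) Y\<^sub>v\<close>. Each tuple \<open>(v/l\<^sup>2) Y\<^sub>v\<close> is commuting, with
  joint eigenvalues \<open>(\<mu>/l\<^sup>2) v\<close> for \<open>\<mu>\<close> an eigenvalue of \<open>Y\<^sub>v\<close>; these points lie in \<open>K\<close>, since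
  a hyperplane separating one of them from \<open>K\<close> pulls back along the projection onto \<open>v\<close> to a
  linear inequality valid on \<open>K\<close> and violated by \<open>X\<close>. The average is the compression of the direct
  sum of these tuples by the isometry \<open>x \<mapsto> (x, \<dots>, x) / \<surd>N\<close>. After diagonalising every \<open>Y\<^sub>v\<close> the
  direct sum becomes a tuple of diagonal operators on a coordinate space.
\<close>

subsection \<open>Unitary diagonalization of Hermitian matrices\<close>

lemma mat_adjoint_carrier [simp]: "A \<in> carrier_mat n m \<Longrightarrow> mat_adjoint A \<in> carrier_mat m n"
  unfolding mat_adjoint_def mat_of_rows_def by auto

lemma mat_adjoint_dim [simp]:
  "dim_row (mat_adjoint A) = dim_col A" "dim_col (mat_adjoint A) = dim_row A"
  unfolding mat_adjoint_def by auto

lemma mat_adjoint_index [simp]: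
  assumes "i < dim_col A" "j < dim_row A"
  shows "mat_adjoint A $$ (i, j) = conjugate (A $$ (j, i))"
  using assms unfolding mat_adjoint_def by (simp add: mat_of_rows_def)

lemma mat_adjoint_adjoint: "mat_adjoint (mat_adjoint (A :: complex mat)) = A"
  by (rule eq_matI) auto

lemma mat_adjoint_one [simp]: "mat_adjoint (1\<^sub>m n) = (1\<^sub>m n :: complex mat)"
  by (rule eq_matI) auto

lemma mat_adjoint_mult:
  assumes "(A :: complex mat) \<in> carrier_mat n m" "B \<in> carrier_mat m k"
  shows "mat_adjoint (A * B) = mat_adjoint B * mat_adjoint A"
  by (rule eq_matI)
    (use assms in \<open>auto simp: scalar_prod_def mult.commute intro!: sum.cong\<close>)

text \<open>The form is conjugate-linear in its second argument, hence the reversed order of the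
  columns. With \<open>A = B = W\<close> this reads \<open>mat_adjoint W * W = 1\<^sub>m n\<close>
  as orthonormality of the columns of \<open>W\<close>.\<close>

lemma mat_adjoint_mult_index:
  assumes "A \<in> carrier_mat n m" "B \<in> carrier_mat n k" "i < m" "j < k"
  shows "(mat_adjoint (A :: complex mat) * B) $$ (i, j) = Matrix.col B j \<bullet>c Matrix.col A i"
  using assms by (auto simp: scalar_prod_def mult.commute intro!: sum.cong)

lemma mat_adjoint_four_block_diag:
  assumes "(A :: complex mat) \<in> carrier_mat n n" "B \<in> carrier_mat m m"
  shows "mat_adjoint (four_block_mat A (0\<^sub>m n m) (0\<^sub>m m n) B) =
    four_block_mat (mat_adjoint A) (0\<^sub>m n m) (0\<^sub>m m n) (mat_adjoint B)"
  by (rule eq_matI) (use assms in auto)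

lemma mult_four_block_diag:
  assumes "(A :: complex mat) \<in> carrier_mat n n" "B \<in> carrier_mat m m"
    and "(C :: complex mat) \<in> carrier_mat n n" "D \<in> carrier_mat m m"
  shows "four_block_mat A (0\<^sub>m n m) (0\<^sub>m m n) B * four_block_mat C (0\<^sub>m n m) (0\<^sub>m m n) D =
    four_block_mat (A * C) (0\<^sub>m n m) (0\<^sub>m m n) (B * D)"
proof -
  have e: "0\<^sub>m m n \<in> carrier_mat m n" "0\<^sub>m n m \<in> carrier_mat n m" by auto
  show ?thesis
    by (subst mult_four_block_mat[OF assms(1) e(2) e(1) assms(2) assms(3) e(2) e(1) assms(4)])
      (use assms in simp)
qed

section \<open>The spectral theorem by deflation\<close>

text \<open>The characteristic polynomial splits over the complex numbers, so an eigenvector exists.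
  It is completed to a basis and orthogonalised; Gram-Schmidt keeps the first vector, so the
  eigenvector survives as column 0 up to scaling.\<close>

lemma unitary_of_eigenvector:
  fixes A :: "complex mat"
  assumes A: "A \<in> carrier_mat n n" and n: "0 < n"
  obtains W e where "W \<in> carrier_mat n n" "mat_adjoint W * W = 1\<^sub>m n"
    "A *\<^sub>v Matrix.col W 0 = e \<cdot>\<^sub>v Matrix.col W 0"
proof -
  from char_poly_factorized[OF A] obtain as where as: "char_poly A = (\<Prod>a\<leftarrow>as. [:- a, 1:])"
    "length as = n" by auto
  with n obtain e es where "as = e # es" by (cases as) auto
  hence "poly (char_poly A) e = 0" using as by simp
  hence "eigenvalue A e" using eigenvalue_root_char_poly[OF A] by simp
  then obtain v where v: "v \<in> carrier_vec n" "v \<noteq> 0\<^sub>v n" "A *\<^sub>v v = e \<cdot>\<^sub>v v"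
    using A unfolding eigenvalue_def eigenvector_def by auto
  interpret cof_vec_space n "TYPE(complex)" .
  define b where "b = basis_completion v"
  define ws where "ws = gram_schmidt n b"
  note bc = basis_completion[OF v(1,2), folded b_def]
  from gram_schmidt_result[OF bc(2,4,5) refl, folded ws_def] bc
  have ws: "set ws \<subseteq> carrier_vec n" "corthogonal ws" "length ws = n" by auto
  from bc n obtain vs where "b = v # vs" by (cases b) auto
  hence hd: "hd ws = v" using gram_schmidt_hd[OF v(1), of vs] by (simp add: ws_def)
  have ws0: "ws ! 0 = v" using hd ws(3) n by (cases ws) auto
  \<comment> \<open>The vectors \<open>ws\<close> are orthogonal but not normalised;
    \<open>c w\<close> is the reciprocal of the length of \<open>w\<close>.\<close>
  define c where "c w = complex_of_real (1 / sqrt (Re (w \<bullet>c w)))" for w :: "complex vec"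
  define W where "W = mat_of_cols n (map (\<lambda>w. c w \<cdot>\<^sub>v w) ws)"
  have W: "W \<in> carrier_mat n n" using ws(3) by (auto simp: W_def mat_of_cols_def)
  have wsi: "ws ! i \<in> carrier_vec n" if "i < n" for i using that ws by auto
  have col: "Matrix.col W i = c (ws ! i) \<cdot>\<^sub>v (ws ! i)" if "i < n" for i
    unfolding W_def by (subst col_mat_of_cols) (use that ws wsi in auto)
  have "mat_adjoint W * W = 1\<^sub>m n"
  proof (rule eq_matI)
    fix i j assume "i < dim_row (1\<^sub>m n)" "j < dim_col (1\<^sub>m n)"
    hence ij: "i < n" "j < n" by auto
    have "(mat_adjoint W * W) $$ (i, j) = c (ws ! j) * cnj (c (ws ! i)) * (ws ! j \<bullet>c ws ! i)"
      using ij wsi[OF ij(1)] wsi[OF ij(2)]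
      by (subst mat_adjoint_mult_index[OF W W])
        (auto simp: col conjugate_smult_vec scalar_prod_smult_distrib[of _ n]
          smult_scalar_prod_distrib[of _ n])
    also have "\<dots> = 1\<^sub>m n $$ (i, j)"
    proof (cases "i = j")
      case False
      then show ?thesis using corthogonalD[OF ws(2), of j i] ws(3) ij by simp
    next
      case True
      let ?w = "ws ! j"
      have "?w \<bullet>c ?w \<ge> 0" by (rule conjugate_square_ge_0_vec)
      moreover have "?w \<bullet>c ?w \<noteq> 0" using corthogonalD[OF ws(2), of j j] ws(3) ij by simp
      ultimately have "Re (?w \<bullet>c ?w) > 0" "?w \<bullet>c ?w = complex_of_real (Re (?w \<bullet>c ?w))"
        by (auto simp: less_eq_complex_def complex_eq_iff order_less_le)
      moreover from this(1) have "1 / sqrt (Re (?w \<bullet>c ?w)) * (1 / sqrt (Re (?w \<bullet>c ?w))) * Re (?w \<bullet>c ?w) = 1"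
        by (simp add: field_simps)
      ultimately have "c ?w * cnj (c ?w) * (?w \<bullet>c ?w) = 1"
        unfolding c_def complex_cnj_complex_of_real by (metis of_real_1 of_real_mult)
      then show ?thesis using True ij by simp
    qed
    finally show "(mat_adjoint W * W) $$ (i, j) = 1\<^sub>m n $$ (i, j)" .
  qed (use W in auto)
  moreover have "A *\<^sub>v Matrix.col W 0 = e \<cdot>\<^sub>v Matrix.col W 0"
    using n A v by (simp add: col ws0 mult_mat_vec smult_smult_assoc mult.commute)
  ultimately show ?thesis using that W by blast
qed

text \<open>In a unitary basis that starts with an eigenvector, the first column of the transformed
  matrix is zero below the corner. The transformed matrix is again self-adjoint, which clears the
  first row and makes the corner entry real.\<close>

lemma unitary_similar_block:
  fixes A :: "complex mat"
  assumes A: "A \<in> carrier_mat (Suc n) (Suc n)" "mat_adjoint A = A"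
  obtains W e A3 where "W \<in> carrier_mat (Suc n) (Suc n)" "mat_adjoint W * W = 1\<^sub>m (Suc n)"
    "A3 \<in> carrier_mat n n" "mat_adjoint A3 = A3"
    "mat_adjoint W * A * W =
      four_block_mat (complex_of_real e \<cdot>\<^sub>m 1\<^sub>m 1) (0\<^sub>m 1 n) (0\<^sub>m n 1) A3"
proof -
  obtain W e where W: "W \<in> carrier_mat (Suc n) (Suc n)" "mat_adjoint W * W = 1\<^sub>m (Suc n)"
    and e: "A *\<^sub>v Matrix.col W 0 = e \<cdot>\<^sub>v Matrix.col W 0"
    using unitary_of_eigenvector[OF A(1)] by blast
  define B where "B = mat_adjoint W * A * W"
  have B: "B \<in> carrier_mat (Suc n) (Suc n)" using A W unfolding B_def
    by (meson mat_adjoint_carrier mult_carrier_mat)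
  have Wa: "mat_adjoint W \<in> carrier_mat (Suc n) (Suc n)" using W by simp
  have BB: "mat_adjoint B = B"
    unfolding B_def mat_adjoint_mult[OF mult_carrier_mat[OF Wa A(1)] W(1)]
      mat_adjoint_mult[OF Wa A(1)] mat_adjoint_adjoint A(2)
    by (rule assoc_mult_mat[OF Wa A(1) W(1), symmetric])
  have conj: "B $$ (i, j) = cnj (B $$ (j, i))" if "i < Suc n" "j < Suc n" for i j
    using that B arg_cong[OF BB, of "\<lambda>M. M $$ (i, j)"] by (simp del: BB)
  have B0: "B $$ (i, 0) = (if i = 0 then e else 0)" if i: "i < Suc n" for i
  proof -
    have "Matrix.col (A * W) 0 = e \<cdot>\<^sub>v Matrix.col W 0"
      using A W e by (subst col_mult2[OF A(1) W(1)]) auto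
    hence "B $$ (i, 0) = (e \<cdot>\<^sub>v Matrix.col W 0) \<bullet>c Matrix.col W i"
      unfolding B_def assoc_mult_mat[OF Wa A(1) W(1)]
      using mat_adjoint_mult_index[OF W(1) mult_carrier_mat[OF A(1) W(1)] i, of 0] by simp
    also have "\<dots> = e * (Matrix.col W 0 \<bullet>c Matrix.col W i)" using W i
      by (subst smult_scalar_prod_distrib[of _ "Suc n"]) (auto intro!: carrier_vecI)
    also have "Matrix.col W 0 \<bullet>c Matrix.col W i = 1\<^sub>m (Suc n) $$ (i, 0)"
      using mat_adjoint_mult_index[OF W(1) W(1) i, of 0] W by simp
    finally show ?thesis using i by simp
  qed
  have "e = cnj e" using conj[of 0 0] B0[of 0] by simp
  hence e: "e = complex_of_real (Re e)" by (simp add: complex_eq_iff)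
  have B0': "B $$ (0, j) = (if j = 0 then e else 0)" if "j < Suc n" for j
    unfolding conj[OF zero_less_Suc that] B0[OF that] using \<open>e = cnj e\<close> by simp
  define A3 where "A3 = Matrix.mat n n (\<lambda>(i, j). B $$ (Suc i, Suc j))"
  have A3: "A3 \<in> carrier_mat n n" by (simp add: A3_def)
  have "mat_adjoint A3 = A3"
    by (rule eq_matI) (auto simp: A3_def conj[symmetric])
  moreover have "B = four_block_mat (complex_of_real (Re e) \<cdot>\<^sub>m 1\<^sub>m 1) (0\<^sub>m 1 n) (0\<^sub>m n 1) A3"
  proof (rule eq_matI)
    fix i j
    assume "i < dim_row (four_block_mat (complex_of_real (Re e) \<cdot>\<^sub>m 1\<^sub>m 1) (0\<^sub>m 1 n) (0\<^sub>m n 1) A3)"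
      and "j < dim_col (four_block_mat (complex_of_real (Re e) \<cdot>\<^sub>m 1\<^sub>m 1) (0\<^sub>m 1 n) (0\<^sub>m n 1) A3)"
    hence ij: "i < Suc n" "j < Suc n" using A3 by auto
    show "B $$ (i, j) = four_block_mat (complex_of_real (Re e) \<cdot>\<^sub>m 1\<^sub>m 1) (0\<^sub>m 1 n) (0\<^sub>m n 1) A3 $$ (i, j)"
    proof (cases i)
      case 0
      have "B $$ (0, j) = (if j = 0 then complex_of_real (Re e) else 0)"
        unfolding B0'[OF ij(2)] using e by simp
      with 0 ij A3 show ?thesis by simp
    next
      case (Suc k)
      with B0[OF ij(1)] have "B $$ (Suc k, 0) = 0" by simp
      with Suc ij show ?thesis by (cases j) (simp_all add: A3_def)
    qed
  qed (use B A3 in auto)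
  ultimately show ?thesis using that W A3 unfolding B_def by blast
qed

text \<open>Induction on the size: split off one eigenvalue with \<open>W\<close>, diagonalise the
  remaining block by some \<open>P\<close>, and use the product of \<open>W\<close> with the block
  matrix of 1 and \<open>P\<close>.\<close>

theorem hermitian_unitary_diagonalization:
  fixes A :: "complex mat"
  assumes "A \<in> carrier_mat n n" "mat_adjoint A = A"
  obtains P d where "P \<in> carrier_mat n n" "mat_adjoint P * P = 1\<^sub>m n"
    "A * P = P * mat_diag n (\<lambda>k. complex_of_real (d k))"
proof -
  have "\<exists>P d. P \<in> carrier_mat n n \<and> mat_adjoint P * P = 1\<^sub>m n \<and>
      A * P = P * mat_diag n (\<lambda>k. complex_of_real (d k))"
    using assms
  proof (induction n arbitrary: A)
    case 0
    then have "A = 0\<^sub>m 0 0" by auto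
    then show ?case by (intro exI[of _ "1\<^sub>m 0"]) (auto simp: mat_diag_def intro!: eq_matI)
  next
    case (Suc n)
    from unitary_similar_block[OF Suc.prems] obtain W e A3 where
      W: "W \<in> carrier_mat (Suc n) (Suc n)" "mat_adjoint W * W = 1\<^sub>m (Suc n)"
      and A3: "A3 \<in> carrier_mat n n" "mat_adjoint A3 = A3"
      and B: "mat_adjoint W * A * W =
        four_block_mat (complex_of_real e \<cdot>\<^sub>m 1\<^sub>m 1) (0\<^sub>m 1 n) (0\<^sub>m n 1) A3"
      by metis
    from Suc.IH[OF A3] obtain P d where P: "P \<in> carrier_mat n n" "mat_adjoint P * P = 1\<^sub>m n"
      and d: "A3 * P = P * mat_diag n (\<lambda>k. complex_of_real (d k))" by blast
    let ?N = "Suc n"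
    note A = Suc.prems(1)
    define Q where "Q = four_block_mat (1\<^sub>m 1) (0\<^sub>m 1 n) (0\<^sub>m n 1) P"
    define D where "D = mat_diag ?N (\<lambda>k. complex_of_real (case k of 0 \<Rightarrow> e | Suc k \<Rightarrow> d k))"
    have Dc: "D \<in> carrier_mat ?N ?N" by (simp add: D_def)
    have Q: "Q \<in> carrier_mat ?N ?N" using P by (auto simp: Q_def)
    have D: "D = four_block_mat (complex_of_real e \<cdot>\<^sub>m 1\<^sub>m 1) (0\<^sub>m 1 n) (0\<^sub>m n 1)
        (mat_diag n (\<lambda>k. complex_of_real (d k)))"
      by (rule eq_matI) (auto simp: D_def mat_diag_def split: nat.split)
    have QQ: "mat_adjoint Q * Q = 1\<^sub>m ?N"
      unfolding Q_def using P
      by (simp add: mat_adjoint_four_block_diag[OF _ P(1)] mult_four_block_diag)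
    have BQ: "(mat_adjoint W * A * W) * Q = Q * D"
      unfolding B D Q_def using P A3 d
      by (simp add: mult_four_block_diag)
    have Wa: "mat_adjoint W \<in> carrier_mat ?N ?N" and Qa: "mat_adjoint Q \<in> carrier_mat ?N ?N"
      using W Q by auto
    \<comment> \<open>For square matrices a left inverse is a right inverse; this lets
      \<open>W * mat_adjoint W\<close> be inserted in front of \<open>A\<close> below.\<close>
    have WW: "W * mat_adjoint W = 1\<^sub>m ?N" by (rule mat_mult_left_right_inverse[OF Wa W])
    have "mat_adjoint W * (W * Q) = Q"
      using Q W(2) by (subst assoc_mult_mat[OF Wa W(1) Q, symmetric]) simp
    hence 1: "mat_adjoint (W * Q) * (W * Q) = 1\<^sub>m ?N"
      unfolding mat_adjoint_mult[OF W(1) Q]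
      by (subst assoc_mult_mat[OF Qa Wa mult_carrier_mat[OF W(1) Q]]) (simp add: QQ)
    have "A * (W * Q) = (W * mat_adjoint W) * (A * (W * Q))" using WW A W Q by simp
    also have "\<dots> = W * ((mat_adjoint W * A * W) * Q)"
      using W Q Wa A by (simp add: assoc_mult_mat[of _ ?N ?N _ ?N _ ?N])
    also have "\<dots> = (W * Q) * D" unfolding BQ using W Q Dc by simp
    finally show ?case using 1 W Q unfolding D_def by (meson mult_carrier_mat)
  qed
  with that show ?thesis by blast
qed

subsection \<open>Diagonal operators on coordinate spaces and compressions\<close>

text \<open>Complex \<open>m\<close>-space is encoded by sequences that vanish from index
  \<open>m\<close> on, because \<open>Wmin_level\<close> asks for a space whose elements have type
  \<open>nat \<Rightarrow> complex\<close>.\<close>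

definition fun_space :: "nat \<Rightarrow> (nat \<Rightarrow> complex) hilbert" where
  "fun_space m = \<lparr>carrier = {f. \<forall>k\<ge>m. f k = 0}, mult = (\<lambda>f g. g), one = (\<lambda>k. 0),
     zero = (\<lambda>k. 0), add = (\<lambda>f g k. f k + g k), smult = (\<lambda>a f k. a * f k),
     cinner = (\<lambda>f g. \<Sum>k<m. f k * cnj (g k))\<rparr>"

lemma fun_space_simps [simp]:
  "f \<in> carrier (fun_space m) \<longleftrightarrow> (\<forall>k\<ge>m. f k = 0)"
  "\<zero>\<^bsub>fun_space m\<^esub> = (\<lambda>k. 0)"
  "f \<oplus>\<^bsub>fun_space m\<^esub> g = (\<lambda>k. f k + g k)"
  "a \<odot>\<^bsub>fun_space m\<^esub> f = (\<lambda>k. a * f k)"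
  "cinner (fun_space m) f g = (\<Sum>k<m. f k * cnj (g k))"
  by (auto simp: fun_space_def)

lemma fun_space_abelian_group: "abelian_group (fun_space m)"
proof (rule abelian_groupI)
  fix x assume x: "x \<in> carrier (fun_space m)"
  show "\<exists>y\<in>carrier (fun_space m). y \<oplus>\<^bsub>fun_space m\<^esub> x = \<zero>\<^bsub>fun_space m\<^esub>"
    by (rule bexI[of _ "\<lambda>k. - x k"]) (use x in auto)
qed (auto simp: add_ac)

lemma fun_space_vectorspace: "vectorspace (class_ring :: complex ring) (fun_space m)"
proof -
  interpret abelian_group "fun_space m" by (rule fun_space_abelian_group)
  interpret field "class_ring :: complex ring" by (rule class_field)
  show ?thesis by unfold_locales (auto simp: algebra_simps)
qed

lemma fun_space_minus [simp]:
  assumes "f \<in> carrier (fun_space m)" "g \<in> carrier (fun_space m)"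
  shows "f \<ominus>\<^bsub>fun_space m\<^esub> g = (\<lambda>k. f k - g k)"
proof -
  interpret abelian_group "fun_space m" by (rule fun_space_abelian_group)
  have "\<ominus>\<^bsub>fun_space m\<^esub> g = (\<lambda>k. - g k)"
    by (rule minus_equality) (use assms in auto)
  thus ?thesis by (simp add: a_minus_def)
qed

lemma hnorm_fun_space: "hnorm (fun_space m) f = sqrt (\<Sum>k<m. (norm (f k))\<^sup>2)"
  unfolding hnorm_def by (simp add: cmod_power2 sum.distrib flip: power2_eq_square)

lemma norm_le_hnorm_fun_space: "k < m \<Longrightarrow> norm (f k) \<le> hnorm (fun_space m) f"
  unfolding hnorm_fun_space
  by (rule real_le_rsqrt) (rule member_le_sum, auto)

lemma hilbert_space_fun_space: "hilbert_space (fun_space m)"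
proof -
  interpret vectorspace "class_ring :: complex ring" "fun_space m" by (rule fun_space_vectorspace)
  show ?thesis
  proof unfold_locales
    fix x assume x: "x \<in> carrier (fun_space m)" "cinner (fun_space m) x x = 0"
    have "hnorm (fun_space m) x = 0" using x(2) by (simp add: hnorm_def)
    hence "x k = 0" for k
      using x(1) norm_le_hnorm_fun_space[of k m x] by (cases "k < m") auto
    thus "x = \<zero>\<^bsub>fun_space m\<^esub>" by auto
  next
    fix s :: "nat \<Rightarrow> nat \<Rightarrow> complex"
    assume s: "\<And>k. s k \<in> carrier (fun_space m)"
      and cauchy: "\<And>e. e > 0 \<Longrightarrow>
        \<exists>M. \<forall>i\<ge>M. \<forall>k\<ge>M. hnorm (fun_space m) (s i \<ominus>\<^bsub>fun_space m\<^esub> s k) < e"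
    have "Cauchy (\<lambda>i. s i k)" if "k < m" for k
    proof (rule CauchyI)
      fix e :: real assume "e > 0"
      from cauchy[OF this] obtain M where M:
        "\<forall>i\<ge>M. \<forall>j\<ge>M. hnorm (fun_space m) (s i \<ominus>\<^bsub>fun_space m\<^esub> s j) < e" by blast
      show "\<exists>M. \<forall>i\<ge>M. \<forall>j\<ge>M. norm (s i k - s j k) < e"
      proof (intro exI allI impI)
        fix i j assume "M \<le> i" "M \<le> j"
        with M have "hnorm (fun_space m) (s i \<ominus>\<^bsub>fun_space m\<^esub> s j) < e" by blast
        with norm_le_hnorm_fun_space[OF that, of "\<lambda>k. s i k - s j k"]
        show "norm (s i k - s j k) < e" using s by simp
      qed
    qed
    hence "convergent (\<lambda>i. s i k)" if "k < m" for k
      using that Cauchy_convergent_iff by blast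
    then obtain L where L: "(\<lambda>i. s i k) \<longlonglongrightarrow> L k" if "k < m" for k
      unfolding convergent_def by metis
    \<comment> \<open>The coordinatewise limit, padded by 0 so that it lies in the carrier; with
      finitely many coordinates this is also the limit in norm.\<close>
    define x where "x k = (if k < m then L k else 0)" for k
    have x: "x \<in> carrier (fun_space m)" by (simp add: x_def)
    have "(\<lambda>i. sqrt (\<Sum>k<m. (norm (s i k - x k))\<^sup>2)) \<longlonglongrightarrow> sqrt (\<Sum>k<m. (norm (x k - x k))\<^sup>2)"
      by (intro tendsto_intros) (use L in \<open>auto simp: x_def\<close>)
    hence "(\<lambda>i. hnorm (fun_space m) (s i \<ominus>\<^bsub>fun_space m\<^esub> x)) \<longlonglongrightarrow> 0"
      using s x by (simp add: hnorm_fun_space)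
    with x show "\<exists>x\<in>carrier (fun_space m).
        (\<lambda>i. hnorm (fun_space m) (s i \<ominus>\<^bsub>fun_space m\<^esub> x)) \<longlonglongrightarrow> 0" by blast
  qed (auto simp: algebra_simps sum.distrib sum_distrib_left intro!: add_nonneg_nonneg sum_nonneg)
qed

section \<open>Adjoints and diagonal operators\<close>

text \<open>\<open>hadjoint\<close> is a definite description, so uniqueness has to be shown:
  nondegeneracy on \<open>G\<close> fixes the values on the carrier, extensionality the rest.
  Nondegeneracy is a hypothesis, so that the rule applies to \<open>cvec_space n\<close> without a
  proof of completeness.\<close>

lemma hadjoint_eqI:
  assumes S: "S \<in> bounded_ops H G"
    and adj: "\<And>x y. x \<in> carrier G \<Longrightarrow> y \<in> carrier H \<Longrightarrow>
      cinner H (T x) y = cinner G x (S y)"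
    and nondeg: "\<And>u v. u \<in> carrier G \<Longrightarrow> v \<in> carrier G \<Longrightarrow>
      (\<And>x. x \<in> carrier G \<Longrightarrow> cinner G x u = cinner G x v) \<Longrightarrow> u = v"
  shows "hadjoint G H T = S"
  unfolding hadjoint_def
proof (rule the_equality)
  fix S' assume S': "S' \<in> bounded_ops H G \<and>
    (\<forall>x\<in>carrier G. \<forall>y\<in>carrier H. cinner H (T x) y = cinner G x (S' y))"
  have "S' y = S y" if y: "y \<in> carrier H" for y
  proof (rule nondeg)
    show "S' y \<in> carrier G" "S y \<in> carrier G"
      using S S' y unfolding bounded_ops_def module_hom_def by auto
    show "cinner G x (S' y) = cinner G x (S y)" if "x \<in> carrier G" for x
      using S' adj[OF that y] that y by force
  qed
  thus "S' = S"
    using S S' unfolding bounded_ops_def by (auto intro: extensionalityI)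
qed (use S adj in auto)

lemma fun_space_nondegenerate:
  assumes "u \<in> carrier (fun_space m)" "v \<in> carrier (fun_space m)"
    and eq: "\<And>x. x \<in> carrier (fun_space m) \<Longrightarrow>
      cinner (fun_space m) x u = cinner (fun_space m) x v"
  shows "u = v"
proof
  fix k
  show "u k = v k"
  proof (cases "k < m")
    case True
    \<comment> \<open>Pairing with a coordinate vector reads off one conjugated coordinate.\<close>
    have "cinner (fun_space m) (\<lambda>j. if j = k then 1 else 0) w = cnj (w k)" for w
      using True by (simp add: if_distrib[of "\<lambda>a. a * _"] cong: if_cong)
    with eq[of "\<lambda>j. if j = k then 1 else 0"] True show ?thesis by simp
  qed (use assms in auto)
qed

text \<open>The restriction to the carrier provides the extensionality that
  \<open>bounded_ops\<close> demands. Vectors vanish from index \<open>m\<close> on, so operators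
  whose coefficients agree below \<open>m\<close> are equal.\<close>

definition diag_op :: "nat \<Rightarrow> (nat \<Rightarrow> complex) \<Rightarrow> (nat \<Rightarrow> complex) \<Rightarrow> nat \<Rightarrow> complex" where
  "diag_op m c = (\<lambda>f\<in>carrier (fun_space m). \<lambda>k. c k * f k)"

lemma diag_op_bounded: "diag_op m c \<in> bounded_ops (fun_space m) (fun_space m)"
proof -
  \<comment> \<open>The sum of all moduli dominates each single one and so serves as an operator
    bound, also for \<open>m = 0\<close>.\<close>
  have "hnorm (fun_space m) (\<lambda>k. c k * f k) \<le> (\<Sum>k<m. norm (c k)) * hnorm (fun_space m) f" for f
  proof -
    have "(\<Sum>k<m. (norm (c k * f k))\<^sup>2) \<le> (\<Sum>k<m. ((\<Sum>k<m. norm (c k)) * norm (f k))\<^sup>2)"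
      unfolding norm_mult
      by (intro sum_mono power_mono mult_right_mono member_le_sum) auto
    also have "\<dots> = (\<Sum>k<m. norm (c k))\<^sup>2 * (\<Sum>k<m. (norm (f k))\<^sup>2)"
      by (simp add: power_mult_distrib sum_distrib_left)
    finally have "sqrt (\<Sum>k<m. (norm (c k * f k))\<^sup>2) \<le>
        sqrt ((\<Sum>k<m. norm (c k))\<^sup>2 * (\<Sum>k<m. (norm (f k))\<^sup>2))" by (rule real_sqrt_le_mono)
    thus ?thesis by (simp add: hnorm_fun_space real_sqrt_mult sum_nonneg)
  qed
  thus ?thesis
    unfolding bounded_ops_def module_hom_def diag_op_def
    by (auto simp: algebra_simps intro!: exI[of _ "\<Sum>k<m. norm (c k)"])
qed

lemma hadjoint_diag_op:
  "hadjoint (fun_space m) (fun_space m) (diag_op m c) = diag_op m (\<lambda>k. cnj (c k))"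
  by (rule hadjoint_eqI[OF diag_op_bounded])
    (auto simp: diag_op_def algebra_simps intro: fun_space_nondegenerate)

lemma op_mult_diag_op:
  "op_mult (fun_space m) (diag_op m a) (diag_op m b) = diag_op m (\<lambda>k. a k * b k)"
  by (auto simp: op_mult_def compose_def diag_op_def fun_eq_iff)

lemma op_add_diag_op:
  "op_add (fun_space m) (diag_op m a) (diag_op m b) = diag_op m (\<lambda>k. a k + b k)"
  by (auto simp: op_add_def diag_op_def fun_eq_iff algebra_simps)

lemma op_smult_diag_op: "op_smult (fun_space m) t (diag_op m b) = diag_op m (\<lambda>k. t * b k)"
  by (auto simp: op_smult_def diag_op_def fun_eq_iff)

lemma op_id_fun_space: "op_id (fun_space m) = diag_op m (\<lambda>k. 1)"
  by (auto simp: op_id_def diag_op_def)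

lemma normal_diag_op: "normal_op (fun_space m) (diag_op m c)"
  by (simp add: normal_op_def diag_op_bounded hadjoint_diag_op op_mult_diag_op mult.commute)

section \<open>Characters and the joint spectrum\<close>

text \<open>Each closure property passes to the intersection of all algebras that contain the
  \<open>N i\<close>. These are the operations on which a character can be evaluated.\<close>

lemma cstar_generated_closed:
  "op_id H \<in> cstar_generated H N"
  "N i \<in> cstar_generated H N"
  "S \<in> cstar_generated H N \<Longrightarrow> T \<in> cstar_generated H N \<Longrightarrow> op_add H S T \<in> cstar_generated H N"
  "S \<in> cstar_generated H N \<Longrightarrow> T \<in> cstar_generated H N \<Longrightarrow> op_mult H S T \<in> cstar_generated H N"
  "T \<in> cstar_generated H N \<Longrightarrow> op_smult H a T \<in> cstar_generated H N"
  unfolding cstar_generated_def by (auto simp: unital_cstar_subalgebra_def)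

text \<open>If \<open>\<phi>\<close> were at none of the points \<open>p k\<close>, it would not vanish on
  \<open>\<Prod>\<^sub>k (N\<^sub>j\<^sub>(\<^sub>k\<^sub>) - p k j(k)) = 0\<close>, where coordinate \<open>j(k)\<close> separates \<open>\<phi>\<close> from \<open>p k\<close>.\<close>

lemma joint_spectrum_diag_op:
  fixes p :: "nat \<Rightarrow> complex ^ 'd"
  shows "joint_spectrum (fun_space m) (\<lambda>i. diag_op m (\<lambda>k. p k $ i)) \<subseteq> p ` {..<m}"
proof
  let ?H = "fun_space m" and ?N = "\<lambda>i. diag_op m (\<lambda>k. p k $ i)"
  let ?C = "cstar_generated ?H ?N"
  fix z assume "z \<in> joint_spectrum ?H ?N"
  then obtain \<phi> where z: "z = (\<chi> i. \<phi> (?N i))" and \<phi>: "character_on ?H ?C \<phi>"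
    unfolding joint_spectrum_def by blast
  have id: "\<phi> (diag_op m (\<lambda>k. 1)) = 1"
    and add: "\<And>S T. S \<in> ?C \<Longrightarrow> T \<in> ?C \<Longrightarrow> \<phi> (op_add ?H S T) = \<phi> S + \<phi> T"
    and mult: "\<And>S T. S \<in> ?C \<Longrightarrow> T \<in> ?C \<Longrightarrow> \<phi> (op_mult ?H S T) = \<phi> S * \<phi> T"
    and smult: "\<And>a T. T \<in> ?C \<Longrightarrow> \<phi> (op_smult ?H a T) = a * \<phi> T"
    using \<phi> unfolding character_on_def op_id_fun_space by auto
  have idC: "diag_op m (\<lambda>k. 1) \<in> ?C"
    using cstar_generated_closed(1)[of ?H ?N] by (simp add: op_id_fun_space)
  show "z \<in> p ` {..<m}"
  proof (rule ccontr)
    assume "z \<notin> p ` {..<m}"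
    hence "\<forall>k<m. \<exists>i. z $ i \<noteq> p k $ i"
    proof (intro allI impI)
      fix k assume "k < m"
      with \<open>z \<notin> p ` {..<m}\<close> have "z \<noteq> p k" by auto
      thus "\<exists>i. z $ i \<noteq> p k $ i" by (simp add: Finite_Cartesian_Product.vec_eq_iff)
    qed
    then obtain j where j: "z $ j k \<noteq> p k $ j k" if "k < m" for k by metis
    \<comment> \<open>Coefficients of coordinate operator \<open>j k\<close> minus the scalar
      \<open>p k $ j k\<close>: they vanish at position \<open>k\<close>, whereas for
      \<open>k < m\<close> the value of the character on this operator is nonzero.\<close>
    define c where "c k r = p r $ j k - p k $ j k" for k r
    have cC: "diag_op m (c k) \<in> ?C" and c\<phi>: "\<phi> (diag_op m (c k)) = z $ j k - p k $ j k" for k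
    proof -
      have eq: "diag_op m (c k) =
          op_add ?H (?N (j k)) (op_smult ?H (- p k $ j k) (diag_op m (\<lambda>k. 1)))"
        by (simp add: op_smult_diag_op op_add_diag_op c_def[abs_def])
      show "diag_op m (c k) \<in> ?C" "\<phi> (diag_op m (c k)) = z $ j k - p k $ j k"
        unfolding eq
        by (auto simp: add smult id idC z cstar_generated_closed
            cstar_generated_closed(2)[of "\<lambda>i. diag_op m (\<lambda>k. p k $ i)"])
    qed
    \<comment> \<open>The induction runs over all lengths; that every factor of the value is nonzero
      is used only at length \<open>m\<close>.\<close>
    have prod: "diag_op m (\<lambda>r. \<Prod>k<n. c k r) \<in> ?C \<and>
        \<phi> (diag_op m (\<lambda>r. \<Prod>k<n. c k r)) = (\<Prod>k<n. z $ j k - p k $ j k)" for n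
    proof (induction n)
      case 0
      show ?case using id idC by simp
    next
      case (Suc n)
      have "diag_op m (\<lambda>r. \<Prod>k<Suc n. c k r) =
          op_mult ?H (diag_op m (\<lambda>r. \<Prod>k<n. c k r)) (diag_op m (c n))"
        by (simp add: op_mult_diag_op)
      with Suc cC c\<phi> show ?case by (simp add: mult cstar_generated_closed)
    qed
    have prod0: "(\<Prod>k<m. c k r) = 0" if "r < m" for r
      by (rule prod_zero) (use that in \<open>auto simp: c_def\<close>)
    \<comment> \<open>Below \<open>m\<close> the factor with \<open>k = r\<close> vanishes, and from
      \<open>m\<close> on the vector does. The zero operator is written as 0 times the identity so
      that homogeneity of the character applies.\<close>
    have "diag_op m (\<lambda>r. \<Prod>k<m. c k r) = op_smult ?H 0 (diag_op m (\<lambda>k. 1))"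
      unfolding op_smult_diag_op unfolding diag_op_def
    proof (rule restrict_ext, rule ext)
      fix f r assume f: "f \<in> carrier (fun_space m)"
      show "(\<Prod>k<m. c k r) * f r = 0 * 1 * f r"
      proof (cases "r < m")
        case True
        show ?thesis unfolding prod0[OF True] by simp
      next
        case False
        with f have "f r = 0" by simp
        thus ?thesis by simp
      qed
    qed
    hence "\<phi> (diag_op m (\<lambda>r. \<Prod>k<m. c k r)) = 0" using idC by (simp add: smult)
    with prod[of m] j show False by simp
  qed
qed

section \<open>Column vectors, analysis and synthesis operators\<close>

lemma cscalar_prod_sum:
  "y \<in> carrier_vec n \<Longrightarrow> x \<bullet>c y = (\<Sum>r<n. vec_index x r * cnj (vec_index y r))"
  for x y :: "complex vec"
  by (auto simp: scalar_prod_def lessThan_atLeast0)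

lemma cscalar_prod_commute:
  "x \<in> carrier_vec n \<Longrightarrow> y \<in> carrier_vec n \<Longrightarrow> y \<bullet>c x = cnj (x \<bullet>c y)" for x y :: "complex vec"
  by (simp add: cscalar_prod_sum mult.commute)

lemma cvec_space_simps [simp]:
  "carrier (cvec_space n) = carrier_vec n"
  "\<zero>\<^bsub>cvec_space n\<^esub> = 0\<^sub>v n"
  "x \<oplus>\<^bsub>cvec_space n\<^esub> y = x + y"
  "a \<odot>\<^bsub>cvec_space n\<^esub> x = a \<cdot>\<^sub>v x"
  "cinner (cvec_space n) x y = x \<bullet>c y"
  by (auto simp: cvec_space_def module.extend_def hilbert.fields_def module_vec_def)

lemma hnorm_cvec_space:
  "x \<in> carrier_vec n \<Longrightarrow> hnorm (cvec_space n) x = sqrt (\<Sum>r<n. (norm (vec_index x r))\<^sup>2)"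
  unfolding hnorm_def
  by (simp add: cscalar_prod_sum cmod_power2 sum.distrib flip: power2_eq_square)

lemma cvec_eqI:
  assumes "u \<in> carrier_vec n" "v \<in> carrier_vec n"
    and eq: "\<And>x. x \<in> carrier_vec n \<Longrightarrow> x \<bullet>c u = x \<bullet>c v"
  shows "u = (v :: complex vec)"
proof (rule eq_vecI)
  fix r assume "r < dim_vec v"
  hence r: "r < n" using assms by simp
  have "unit_vec n r \<bullet>c w = cnj (vec_index w r)" if "w \<in> carrier_vec n" for w :: "complex vec"
    using that r by (subst scalar_prod_left_unit[of _ n]) auto
  from this[OF assms(1)] this[OF assms(2)] eq[of "unit_vec n r"]
  have "cnj (vec_index u r) = cnj (vec_index v r)" by simp
  thus "vec_index u r = vec_index v r" by simp
qed (use assms in simp)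

text \<open>The analysis operator of frame theory, sending a vector to its coefficients against
  \<open>w\<close>. It supplies the isometry of the dilation once \<open>w\<close> satisfies the
  Parseval identity.\<close>

definition analysis_op :: "nat \<Rightarrow> nat \<Rightarrow> (nat \<Rightarrow> complex vec) \<Rightarrow> complex vec \<Rightarrow> nat \<Rightarrow> complex" where
  "analysis_op n m w = (\<lambda>x\<in>carrier_vec n. \<lambda>k. if k < m then x \<bullet>c w k else 0)"

definition synthesis_op :: "nat \<Rightarrow> nat \<Rightarrow> (nat \<Rightarrow> complex vec) \<Rightarrow> (nat \<Rightarrow> complex) \<Rightarrow> complex vec" where
  "synthesis_op n m w =
     (\<lambda>f\<in>carrier (fun_space m). Matrix.vec n (\<lambda>r. \<Sum>k<m. f k * vec_index (w k) r))"

lemma synthesis_op_closed: "f \<in> carrier (fun_space m) \<Longrightarrow> synthesis_op n m w f \<in> carrier_vec n"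
  by (simp add: synthesis_op_def)

context
  fixes n m :: nat and w :: "nat \<Rightarrow> complex vec"
  assumes w: "\<And>k. k < m \<Longrightarrow> w k \<in> carrier_vec n"
begin

lemma analysis_op_hom: "analysis_op n m w \<in> module_hom class_ring (cvec_space n) (fun_space m)"
  using w unfolding module_hom_def analysis_op_def
  by (auto simp: fun_eq_iff add_scalar_prod_distrib[of _ n] smult_scalar_prod_distrib[of _ n])

lemma cscalar_prod_synthesis_op:
  assumes "f \<in> carrier (fun_space m)" "x \<in> carrier_vec n"
  shows "x \<bullet>c synthesis_op n m w f = (\<Sum>k<m. analysis_op n m w x k * cnj (f k))"
proof -
  have "x \<bullet>c synthesis_op n m w f =
      (\<Sum>r<n. \<Sum>k<m. vec_index x r * (cnj (f k) * cnj (vec_index (w k) r)))"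
    using assms by (simp add: cscalar_prod_sum[of _ n] synthesis_op_def sum_distrib_left)
  also have "\<dots> = (\<Sum>k<m. \<Sum>r<n. vec_index x r * (cnj (f k) * cnj (vec_index (w k) r)))"
    by (rule sum.swap)
  also have "\<dots> = (\<Sum>k<m. analysis_op n m w x k * cnj (f k))"
    using assms w
    by (intro sum.cong) (auto simp: analysis_op_def cscalar_prod_sum[of _ n] sum_distrib_left mult_ac)
  finally show ?thesis .
qed

lemma synthesis_op_bounded: "synthesis_op n m w \<in> bounded_ops (fun_space m) (cvec_space n)"
proof -
  \<comment> \<open>The Euclidean norm is at most the sum of the moduli of the entries, and each
    coordinate of \<open>f\<close> is at most its norm; together these give the bound
    \<open>c\<close>.\<close>
  define c where "c = (\<Sum>r<n. \<Sum>k<m. norm (vec_index (w k) r))"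
  have "hnorm (cvec_space n) (synthesis_op n m w f) \<le> c * hnorm (fun_space m) f"
    if f: "f \<in> carrier (fun_space m)" for f
  proof -
    let ?f = "hnorm (fun_space m) f"
    have "hnorm (cvec_space n) (synthesis_op n m w f) \<le> (\<Sum>r<n. norm (vec_index (synthesis_op n m w f) r))"
      unfolding hnorm_cvec_space[OF synthesis_op_closed[OF f]]
      using L2_set_le_sum[of "{..<n}" "\<lambda>r. norm (vec_index (synthesis_op n m w f) r)"]
      by (simp add: L2_set_def)
    also have "\<dots> \<le> (\<Sum>r<n. \<Sum>k<m. norm (vec_index (w k) r) * ?f)"
    proof (rule sum_mono)
      fix r assume "r \<in> {..<n}"
      hence "vec_index (synthesis_op n m w f) r = (\<Sum>k<m. f k * vec_index (w k) r)"
        using f by (simp add: synthesis_op_def)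
      also have "norm \<dots> \<le> (\<Sum>k<m. norm (f k * vec_index (w k) r))" by (rule norm_sum)
      also have "\<dots> \<le> (\<Sum>k<m. norm (vec_index (w k) r) * ?f)"
        by (intro sum_mono)
          (auto simp: norm_mult mult.commute intro!: mult_right_mono norm_le_hnorm_fun_space)
      finally show "norm (vec_index (synthesis_op n m w f) r) \<le> (\<Sum>k<m. norm (vec_index (w k) r) * ?f)" .
    qed
    also have "\<dots> = c * ?f" by (simp add: c_def sum_distrib_right)
    finally show ?thesis .
  qed
  moreover have "synthesis_op n m w \<in> module_hom class_ring (fun_space m) (cvec_space n)"
    unfolding module_hom_def synthesis_op_def
    by (auto simp: algebra_simps sum.distrib sum_distrib_left intro!: eq_vecI)
  moreover have "synthesis_op n m w \<in> extensional (carrier (fun_space m))"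
    by (simp add: synthesis_op_def)
  ultimately show ?thesis unfolding bounded_ops_def by blast
qed

lemma hadjoint_analysis_op: "hadjoint (cvec_space n) (fun_space m) (analysis_op n m w) = synthesis_op n m w"
proof (rule hadjoint_eqI)
  show "synthesis_op n m w \<in> bounded_ops (fun_space m) (cvec_space n)" by (rule synthesis_op_bounded)
qed (auto simp: cscalar_prod_synthesis_op intro: cvec_eqI)

end

section \<open>A criterion for membership in the minimal set\<close>

text \<open>The dilation is the tuple of diagonal operators with joint eigenvalues
  \<open>p k\<close>, and \<open>V\<close> is the analysis operator of \<open>w\<close>. Hypothesis
  \<open>parseval\<close> makes \<open>V\<close> isometric, and \<open>Xp\<close> is the compression
  identity tested on pairs of vectors.\<close>

lemma Wmin_levelI:
  fixes p :: "nat \<Rightarrow> real ^ 'd" and w :: "nat \<Rightarrow> complex vec"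
  assumes X: "X \<in> sa_tuples n"
    and w: "\<And>k. k < m \<Longrightarrow> w k \<in> carrier_vec n"
    and p: "\<And>k. k < m \<Longrightarrow> p k \<in> K"
    and parseval: "\<And>x y. x \<in> carrier_vec n \<Longrightarrow> y \<in> carrier_vec n \<Longrightarrow>
      x \<bullet>c y = (\<Sum>k<m. (x \<bullet>c w k) * cnj (y \<bullet>c w k))"
    and Xp: "\<And>i x y. x \<in> carrier_vec n \<Longrightarrow> y \<in> carrier_vec n \<Longrightarrow>
      (X i *\<^sub>v x) \<bullet>c y =
        (\<Sum>k<m. complex_of_real (p k $ i) * ((x \<bullet>c w k) * cnj (y \<bullet>c w k)))"
  shows "X \<in> Wmin_level n K"
proof -
  define V where "V = analysis_op n m w"
  define N where "N i = diag_op m (\<lambda>k. complexify (p k) $ i)" for i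
  let ?L = "fun_space m" and ?C = "cvec_space n"
  have Vc: "V x \<in> carrier ?L" if "x \<in> carrier_vec n" for x
    using that by (simp add: V_def analysis_op_def)
  have Vk: "V x k = x \<bullet>c w k" if "x \<in> carrier_vec n" "k < m" for x k
    using that by (simp add: V_def analysis_op_def)
  have adj: "hadjoint ?C ?L V = synthesis_op n m w"
    unfolding V_def by (rule hadjoint_analysis_op) (rule w)
  have norm: "hnorm ?L (V x) = hnorm ?C x" if x: "x \<in> carrier_vec n" for x
    unfolding hnorm_def using x parseval[OF x x] by (simp add: Vk)
  have "V \<in> bounded_ops ?C ?L"
    unfolding bounded_ops_def
    using norm analysis_op_hom[OF w]
    by (auto simp: V_def analysis_op_def extensional_def intro!: exI[of _ 1])
  hence iso: "hisometry ?C ?L V" using norm by (simp add: hisometry_def)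
  have "joint_spectrum ?L N \<subseteq> (\<lambda>k. complexify (p k)) ` {..<m}"
    unfolding N_def[abs_def] by (rule joint_spectrum_diag_op)
  hence spec: "joint_spectrum ?L N \<subseteq> complexify ` K" using p by auto
  have "X i *\<^sub>v x = hadjoint ?C ?L V (N i (V x))" if x: "x \<in> carrier_vec n" for i x
  proof (rule cvec_eqI)
    have Xi: "X i \<in> carrier_mat n n" using X by (simp add: sa_tuples_def)
    show Xx: "X i *\<^sub>v x \<in> carrier_vec n" using Xi x by simp
    have NV: "N i (V x) \<in> carrier ?L" using Vc[OF x] by (simp add: N_def diag_op_def)
    show "hadjoint ?C ?L V (N i (V x)) \<in> carrier_vec n"
      unfolding adj by (rule synthesis_op_closed[OF NV])
    fix y :: "complex vec" assume y: "y \<in> carrier_vec n"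
    have syn: "y \<bullet>c synthesis_op n m w (N i (V x)) = (\<Sum>k<m. V y k * cnj (N i (V x) k))"
      unfolding V_def by (rule cscalar_prod_synthesis_op[OF w NV[unfolded V_def] y])
    \<comment> \<open>\<open>cvec_eqI\<close> tests in the first slot while \<open>Xp\<close> has
      the operator there; conjugate symmetry exchanges the slots, and the real numbers
      \<open>p k $ i\<close> are unaffected.\<close>
    have "y \<bullet>c (X i *\<^sub>v x) =
        (\<Sum>k<m. (y \<bullet>c w k) * cnj (complex_of_real (p k $ i) * (x \<bullet>c w k)))"
      using cscalar_prod_commute[OF Xx y] Xp[OF x y] by (simp add: mult_ac)
    also have "\<dots> = y \<bullet>c hadjoint ?C ?L V (N i (V x))"
      unfolding adj syn
      using y x Vc[OF x]
      by (intro sum.cong) (auto simp: Vk V_def[symmetric] N_def diag_op_def complexify_def)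
    finally show "y \<bullet>c (X i *\<^sub>v x) = y \<bullet>c hadjoint ?C ?L V (N i (V x))" .
  qed
  moreover have "op_mult ?L (N i) (N j) = op_mult ?L (N j) (N i)" for i j
    by (simp add: N_def op_mult_diag_op mult.commute)
  ultimately show ?thesis
    unfolding Wmin_level_def
    using X hilbert_space_fun_space[of m] spec iso normal_diag_op
    by (auto simp: N_def intro!: exI[of _ ?L] exI[of _ N] exI[of _ V])
qed

text \<open>Enumerating \<open>I\<close> by a bijection allows pairs of a frame vector and an
  eigenvector index as labels.\<close>

lemma Wmin_levelI_finite:
  fixes p :: "'a \<Rightarrow> real ^ 'd" and w :: "'a \<Rightarrow> complex vec"
  assumes I: "finite I"
    and X: "X \<in> sa_tuples n"
    and w: "\<And>k. k \<in> I \<Longrightarrow> w k \<in> carrier_vec n"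
    and p: "\<And>k. k \<in> I \<Longrightarrow> p k \<in> K"
    and parseval: "\<And>x y. x \<in> carrier_vec n \<Longrightarrow> y \<in> carrier_vec n \<Longrightarrow>
      x \<bullet>c y = (\<Sum>k\<in>I. (x \<bullet>c w k) * cnj (y \<bullet>c w k))"
    and Xp: "\<And>i x y. x \<in> carrier_vec n \<Longrightarrow> y \<in> carrier_vec n \<Longrightarrow>
      (X i *\<^sub>v x) \<bullet>c y =
        (\<Sum>k\<in>I. complex_of_real (p k $ i) * ((x \<bullet>c w k) * cnj (y \<bullet>c w k)))"
  shows "X \<in> Wmin_level n K"
proof -
  obtain h where h: "bij_betw h {..<card I} I"
    using ex_bij_betw_nat_finite[OF I] by (auto simp: lessThan_atLeast0)
  have hI: "h k \<in> I" if "k < card I" for k using h that by (auto simp: bij_betw_def)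
  show ?thesis
  proof (rule Wmin_levelI[where m = "card I" and w = "w \<circ> h" and p = "p \<circ> h", OF X])
    fix x y :: "complex vec" assume x: "x \<in> carrier_vec n" and y: "y \<in> carrier_vec n"
    show "x \<bullet>c y = (\<Sum>k<card I. (x \<bullet>c (w \<circ> h) k) * cnj (y \<bullet>c (w \<circ> h) k))"
      unfolding parseval[OF x y] o_def by (rule sum.reindex_bij_betw[OF h, symmetric])
    show "(X i *\<^sub>v x) \<bullet>c y = (\<Sum>k<card I. complex_of_real ((p \<circ> h) k $ i) *
        ((x \<bullet>c (w \<circ> h) k) * cnj (y \<bullet>c (w \<circ> h) k)))" for i
      unfolding Xp[OF x y] o_def by (rule sum.reindex_bij_betw[OF h, symmetric])
  qed (simp_all add: w p hI)
qed

subsection \<open>Matrix inequalities and tight frames\<close>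

lemma cscalar_prod_adjoint:
  fixes A :: "complex mat"
  assumes "A \<in> carrier_mat n m" "x \<in> carrier_vec m" "y \<in> carrier_vec n"
  shows "(A *\<^sub>v x) \<bullet>c y = x \<bullet>c (mat_adjoint A *\<^sub>v y)"
proof -
  have "(A *\<^sub>v x) \<bullet>c y = (\<Sum>r<n. \<Sum>s<m. A $$ (r, s) * vec_index x s * cnj (vec_index y r))"
    using assms
    by (simp add: cscalar_prod_sum[of _ n] scalar_prod_def sum_distrib_right lessThan_atLeast0)
  also have "\<dots> = (\<Sum>s<m. \<Sum>r<n. A $$ (r, s) * vec_index x s * cnj (vec_index y r))"
    by (rule sum.swap)
  also have "\<dots> = x \<bullet>c (mat_adjoint A *\<^sub>v y)"
    using assms mult_mat_vec_carrier[OF mat_adjoint_carrier[OF assms(1)] assms(3)]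
    by (simp add: cscalar_prod_sum[of _ m] scalar_prod_def sum_distrib_left lessThan_atLeast0 mult_ac)
  finally show ?thesis .
qed

lemma smult_mat_mult_vec:
  "A \<in> carrier_mat n m \<Longrightarrow> x \<in> carrier_vec m \<Longrightarrow> (c \<cdot>\<^sub>m A) *\<^sub>v x = c \<cdot>\<^sub>v (A *\<^sub>v x)"
  for A :: "complex mat"
  by (rule eq_vecI) (auto simp: scalar_prod_def sum_distrib_left mult.assoc)

lemma mat_diag_mult_vec:
  "x \<in> carrier_vec n \<Longrightarrow> k < n \<Longrightarrow> vec_index (mat_diag n d *\<^sub>v x) k = d k * vec_index x k"
  for x :: "complex vec"
  by (simp add: mat_diag_def scalar_prod_def if_distrib[of "\<lambda>a. a * _"] cong: if_cong)

text \<open>The decomposition of \<open>A\<close> into rank-one projections is recorded through its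
  form rather than by eigenvector equations, so that later arguments only manipulate finite scalar
  sums.\<close>

definition orthonormal_eigenbasis ::
  "nat \<Rightarrow> complex mat \<Rightarrow> (nat \<Rightarrow> complex vec) \<Rightarrow> (nat \<Rightarrow> real) \<Rightarrow> bool" where
  "orthonormal_eigenbasis n A u d \<longleftrightarrow>
     (\<forall>k<n. u k \<in> carrier_vec n) \<and>
     (\<forall>j<n. \<forall>k<n. u j \<bullet>c u k = (if j = k then 1 else 0)) \<and>
     (\<forall>x\<in>carrier_vec n. \<forall>y\<in>carrier_vec n.
        x \<bullet>c y = (\<Sum>k<n. (x \<bullet>c u k) * cnj (y \<bullet>c u k)) \<and>
        (A *\<^sub>v x) \<bullet>c y =
          (\<Sum>k<n. complex_of_real (d k) * ((x \<bullet>c u k) * cnj (y \<bullet>c u k))))"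

text \<open>The basis consists of the columns of a diagonalising unitary \<open>P\<close>, and the
  coefficients of \<open>x\<close> are the entries of
  \<open>mat_adjoint P *\<^sub>v x\<close>.\<close>

lemma hermitian_orthonormal_eigenbasis:
  fixes A :: "complex mat"
  assumes A: "A \<in> carrier_mat n n" "mat_adjoint A = A"
  shows "\<exists>u d. orthonormal_eigenbasis n A u d"
proof -
  obtain P d where P: "P \<in> carrier_mat n n" "mat_adjoint P * P = 1\<^sub>m n"
    and AP: "A * P = P * mat_diag n (\<lambda>k. complex_of_real (d k))"
    using hermitian_unitary_diagonalization[OF A] by blast
  let ?D = "mat_diag n (\<lambda>k. complex_of_real (d k))"
  have Pa: "mat_adjoint P \<in> carrier_mat n n" using P by simp
  have PP: "P * mat_adjoint P = 1\<^sub>m n" by (rule mat_mult_left_right_inverse[OF Pa P])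
  define u where "u k = Matrix.col P k" for k
  have u: "u k \<in> carrier_vec n" if "k < n" for k
    using P(1) by (auto simp: u_def intro!: carrier_vecI)
  have coeff: "vec_index (mat_adjoint P *\<^sub>v x) k = x \<bullet>c u k"
    if "x \<in> carrier_vec n" "k < n" for x k
    using that P(1) u[OF that(2)]
    by (simp add: cscalar_prod_sum scalar_prod_def lessThan_atLeast0 u_def mult.commute)
  have coeff_carrier: "mat_adjoint P *\<^sub>v x \<in> carrier_vec n" if "x \<in> carrier_vec n" for x
    using Pa that by simp
  have orth: "u j \<bullet>c u k = (if j = k then 1 else 0)" if "j < n" "k < n" for j k
    using mat_adjoint_mult_index[OF P(1) P(1) that(2,1)] P that by (auto simp: u_def)
  \<comment> \<open>Taking the identity for \<open>E\<close> gives the Parseval identity; taking the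
    diagonal matrix gives the form of \<open>A\<close>.\<close>
  have form: "(P *\<^sub>v (E *\<^sub>v (mat_adjoint P *\<^sub>v x))) \<bullet>c y =
      (\<Sum>k<n. vec_index (E *\<^sub>v (mat_adjoint P *\<^sub>v x)) k * cnj (y \<bullet>c u k))"
    if "x \<in> carrier_vec n" "y \<in> carrier_vec n" "E \<in> carrier_mat n n" for x y E
    using that coeff_carrier
    by (subst cscalar_prod_adjoint[OF P(1)]) (auto simp: cscalar_prod_sum[of _ n] coeff)
  have "x \<bullet>c y = (\<Sum>k<n. (x \<bullet>c u k) * cnj (y \<bullet>c u k))"
    if x: "x \<in> carrier_vec n" and y: "y \<in> carrier_vec n" for x y
  proof -
    have "P *\<^sub>v (1\<^sub>m n *\<^sub>v (mat_adjoint P *\<^sub>v x)) = x"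
      using x coeff_carrier[OF x] PP assoc_mult_mat_vec[OF P(1) Pa x] by simp
    with form[OF x y, of "1\<^sub>m n"] x coeff_carrier[OF x] show ?thesis by (simp add: coeff)
  qed
  moreover have "(A *\<^sub>v x) \<bullet>c y =
      (\<Sum>k<n. complex_of_real (d k) * ((x \<bullet>c u k) * cnj (y \<bullet>c u k)))"
    if x: "x \<in> carrier_vec n" and y: "y \<in> carrier_vec n" for x y
  proof -
    have "A = A * (P * mat_adjoint P)" using PP A by simp
    also have "\<dots> = P * ?D * mat_adjoint P"
      unfolding AP[symmetric] by (rule assoc_mult_mat[OF A(1) P(1) Pa, symmetric])
    finally have "A *\<^sub>v x = (P * ?D * mat_adjoint P) *\<^sub>v x" by (rule arg_cong)
    also have "\<dots> = (P * ?D) *\<^sub>v (mat_adjoint P *\<^sub>v x)"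
      by (rule assoc_mult_mat_vec[OF mult_carrier_mat[OF P(1) mat_diag_dim] Pa x])
    also have "\<dots> = P *\<^sub>v (?D *\<^sub>v (mat_adjoint P *\<^sub>v x))"
      by (rule assoc_mult_mat_vec[OF P(1) mat_diag_dim coeff_carrier[OF x]])
    finally have "A *\<^sub>v x = P *\<^sub>v (?D *\<^sub>v (mat_adjoint P *\<^sub>v x))" .
    with form[OF x y, of ?D] x coeff_carrier[OF x]
    show ?thesis by (simp add: coeff mat_diag_mult_vec mult_ac)
  qed
  ultimately have "orthonormal_eigenbasis n A u d"
    unfolding orthonormal_eigenbasis_def using u orth by blast
  thus ?thesis by blast
qed

section \<open>Linear combinations of a tuple and their forms\<close>

lemma lin_comb_mat_carrier: "lin_comb_mat n \<alpha> X \<in> carrier_mat n n"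
  by (simp add: lin_comb_mat_def)

lemma mat_adjoint_lin_comb_mat:
  assumes "X \<in> sa_tuples n"
  shows "mat_adjoint (lin_comb_mat n \<alpha> X) = lin_comb_mat n \<alpha> X"
proof (rule eq_matI)
  have X: "X i \<in> carrier_mat n n" "mat_adjoint (X i) = X i" for i
    using assms by (auto simp: sa_tuples_def)
  fix r s assume "r < dim_row (lin_comb_mat n \<alpha> X)" "s < dim_col (lin_comb_mat n \<alpha> X)"
  hence rs: "r < n" "s < n" by (auto simp: lin_comb_mat_def)
  have "cnj (X i $$ (s, r)) = X i $$ (r, s)" for i
    using mat_adjoint_index[of r "X i" s] X[of i] rs by simp
  thus "mat_adjoint (lin_comb_mat n \<alpha> X) $$ (r, s) = lin_comb_mat n \<alpha> X $$ (r, s)"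
    using rs by (simp add: lin_comb_mat_def)
qed (auto simp: lin_comb_mat_def)

text \<open>Recovers linearity in the coefficients from the entrywise definition by exchanging
  finite sums.\<close>

lemma lin_comb_mat_form:
  assumes "X \<in> sa_tuples n" "x \<in> carrier_vec n" "y \<in> carrier_vec n"
  shows "(lin_comb_mat n \<alpha> X *\<^sub>v x) \<bullet>c y =
    (\<Sum>i\<in>UNIV. complex_of_real (\<alpha> $ i) * ((X i *\<^sub>v x) \<bullet>c y))"
proof -
  have X: "X i \<in> carrier_mat n n" for i using assms by (auto simp: sa_tuples_def)
  hence dim: "dim_row (X i) = n" "dim_col (X i) = n" for i by auto
  have "(lin_comb_mat n \<alpha> X *\<^sub>v x) \<bullet>c y = (\<Sum>r<n. \<Sum>s<n. \<Sum>i\<in>UNIV.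
      complex_of_real (\<alpha> $ i) * (X i $$ (r, s) * vec_index x s * cnj (vec_index y r)))"
    using assms by (simp add: cscalar_prod_sum[of _ n] scalar_prod_def lin_comb_mat_def
        sum_distrib_left sum_distrib_right lessThan_atLeast0 mult_ac)
  also have "\<dots> = (\<Sum>r<n. \<Sum>i\<in>UNIV. \<Sum>s<n.
      complex_of_real (\<alpha> $ i) * (X i $$ (r, s) * vec_index x s * cnj (vec_index y r)))"
    by (intro sum.cong refl sum.swap)
  also have "\<dots> = (\<Sum>i\<in>UNIV. \<Sum>r<n. \<Sum>s<n.
      complex_of_real (\<alpha> $ i) * (X i $$ (r, s) * vec_index x s * cnj (vec_index y r)))"
    by (rule sum.swap)
  also have "\<dots> = (\<Sum>i\<in>UNIV. complex_of_real (\<alpha> $ i) * ((X i *\<^sub>v x) \<bullet>c y))"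
    using assms dim by (simp add: cscalar_prod_sum[of _ n] scalar_prod_def
        sum_distrib_left sum_distrib_right lessThan_atLeast0 mult_ac)
  finally show ?thesis .
qed

lemma mat_le_formD:
  assumes "mat_le n A B" "A \<in> carrier_mat n n" "B \<in> carrier_mat n n" "x \<in> carrier_vec n"
  shows "Re ((A *\<^sub>v x) \<bullet>c x) \<le> Re ((B *\<^sub>v x) \<bullet>c x)"
proof -
  have "0 \<le> ((B - A) *\<^sub>v x) \<bullet>c x" using assms by (simp add: mat_le_def)
  also have "((B - A) *\<^sub>v x) \<bullet>c x = (B *\<^sub>v x) \<bullet>c x - (A *\<^sub>v x) \<bullet>c x"
    using assms by (simp add: minus_mult_distrib_mat_vec[of _ n n] minus_scalar_prod_distrib[of _ n])
  finally show ?thesis by (simp add: less_eq_complex_def)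
qed

section \<open>Frame identities and the points of \<open>K\<close>\<close>

text \<open>Real polarization of the quadratic frame identity; on coordinate vectors it yields the
  entries of the frame operator.\<close>

lemma tight_frame_polarization:
  assumes "\<And>x. (\<Sum>v\<in>F. \<bar>inner x v\<bar>\<^sup>2) = \<sigma> * (norm x)\<^sup>2"
  shows "(\<Sum>v\<in>F. inner x v * inner y v) = \<sigma> * inner x y"
proof -
  have sq: "(\<Sum>v\<in>F. (inner z v)\<^sup>2) = \<sigma> * inner z z" for z
    using assms[of z] by (simp add: power2_norm_eq_inner)
  have "4 * (inner x v * inner y v) = (inner (x + y) v)\<^sup>2 - (inner (x - y) v)\<^sup>2" for v
    by (simp add: inner_add_left inner_diff_left power2_eq_square algebra_simps)
  hence "4 * (\<Sum>v\<in>F. inner x v * inner y v) =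
      (\<Sum>v\<in>F. (inner (x + y) v)\<^sup>2) - (\<Sum>v\<in>F. (inner (x - y) v)\<^sup>2)"
    by (simp only: sum_distrib_left sum_subtractf)
  also have "\<dots> = 4 * (\<sigma> * inner x y)"
    unfolding sq by (simp add: inner_simps inner_commute algebra_simps)
  finally show ?thesis by simp
qed

text \<open>Evaluating the matrix inequality at a unit vector turns its right-hand side into the
  number \<open>a\<close>.\<close>

lemma Wmax_levelD:
  assumes X: "X \<in> Wmax_level n K" and u: "u \<in> carrier_vec n" "u \<bullet>c u = 1"
    and \<alpha>: "\<And>x. x \<in> K \<Longrightarrow> inner \<alpha> x \<le> a"
  shows "Re ((lin_comb_mat n \<alpha> X *\<^sub>v u) \<bullet>c u) \<le> a"
proof -
  have "mat_le n (lin_comb_mat n \<alpha> X) (complex_of_real a \<cdot>\<^sub>m 1\<^sub>m n)"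
    using X \<alpha> by (simp add: Wmax_level_def inner_vec_def)
  from mat_le_formD[OF this lin_comb_mat_carrier _ u(1)]
  show ?thesis using u by (simp add: smult_mat_mult_vec[of _ n n] smult_scalar_prod_distrib[of _ n])
qed

lemma outer_self_mult: "outer_self v *v x = inner v x *\<^sub>R v"
  by (simp add: outer_self_def matrix_vector_mult_def inner_vec_def
      Finite_Cartesian_Product.vec_eq_iff sum_distrib_left mult_ac)

text \<open>The rank-one map is self-adjoint, so a separating functional \<open>a\<close> composed
  with it is represented by a multiple of \<open>v\<close>. In the state given by \<open>u\<close>
  this multiple is evaluated through \<open>\<mu>\<close> alone.\<close>

lemma scaled_eigenvalue_mem:
  fixes K :: "(real ^ 'd) set"
  assumes K: "closed K" "convex K"
    and proj: "\<And>x. x \<in> K \<Longrightarrow> ((1 / l\<^sup>2) *\<^sub>R outer_self v) *v x \<in> K"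
    and X: "X \<in> Wmax_level n K" and u: "u \<in> carrier_vec n" "u \<bullet>c u = 1"
    and lam: "(lin_comb_mat n v X *\<^sub>v u) \<bullet>c u = complex_of_real \<mu>"
  shows "(\<mu> / l\<^sup>2) *\<^sub>R v \<in> K"
proof (rule ccontr)
  assume "(\<mu> / l\<^sup>2) *\<^sub>R v \<notin> K"
  from separating_hyperplane_closed_point[OF K(2,1) this] obtain a b where
    ab: "inner a ((\<mu> / l\<^sup>2) *\<^sub>R v) < b" "\<And>x. x \<in> K \<Longrightarrow> b < inner a x" by blast
  \<comment> \<open>The separation places \<open>K\<close> on the side above \<open>b\<close>; the
    minus sign turns this into an upper bound \<open>-b\<close>, the form that
    \<open>Wmax_levelD\<close> accepts.\<close>
  define c where "c = - inner a v / l\<^sup>2"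
  have Xs: "X \<in> sa_tuples n" using X by (simp add: Wmax_level_def)
  have "inner (c *\<^sub>R v) x \<le> - b" if "x \<in> K" for x
    using ab(2)[OF proj[OF that]]
    by (simp add: c_def outer_self_mult scaleR_matrix_vector_assoc[symmetric] mult_ac)
  from Wmax_levelD[OF X u this]
  have "Re ((lin_comb_mat n (c *\<^sub>R v) X *\<^sub>v u) \<bullet>c u) \<le> - b" .
  also have "(lin_comb_mat n (c *\<^sub>R v) X *\<^sub>v u) \<bullet>c u =
      complex_of_real c * ((lin_comb_mat n v X *\<^sub>v u) \<bullet>c u)"
    by (simp add: lin_comb_mat_form[OF Xs u(1) u(1)] sum_distrib_left mult.assoc)
  finally have "c * \<mu> \<le> - b" by (simp add: lam)
  with ab(1) show False by (simp add: c_def mult_ac)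
qed

text \<open>The trace of the frame operator is \<open>card F * l\<^sup>2\<close> as a sum of squared
  lengths and the dimension times \<open>\<sigma>\<close> by tightness. This determines
  \<open>\<sigma>\<close>, and its positivity forces the frame to be nonempty.\<close>

lemma frame_average:
  fixes F :: "(real ^ 'd) set"
  assumes "isometric_tight_frame F l"
  shows "0 < card F" "0 < l"
    "(\<Sum>v\<in>F. v $ i * v $ j) = (if i = j then real (card F) * l\<^sup>2 / real CARD('d) else 0)"
proof -
  from assms obtain \<sigma> where F: "finite F" "\<sigma> > 0" and
    tight: "\<And>x. (\<Sum>v\<in>F. \<bar>inner x v\<bar>\<^sup>2) = \<sigma> * (norm x)\<^sup>2"
    and l: "l > 0" "\<And>v. v \<in> F \<Longrightarrow> norm v = l"
    unfolding isometric_tight_frame_def tight_frame_def by blast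
  have ij: "(\<Sum>v\<in>F. v $ i * v $ j) = (if i = j then \<sigma> else 0)" for i j
  proof -
    have "inner (axis i 1 :: real ^ 'd) (axis j 1) = (if i = j then 1 else 0)"
      by (simp add: inner_axis_axis)
    with tight_frame_polarization[OF tight, of "axis i 1" "axis j 1"]
    have "(\<Sum>v\<in>F. inner (axis i 1) v * inner (axis j 1) v) = \<sigma> * (if i = j then 1 else 0)"
      by (simp only:)
    thus ?thesis by (simp add: inner_axis')
  qed
  have "real (card F) * l\<^sup>2 = (\<Sum>v\<in>F. (norm v)\<^sup>2)" using l by simp
  also have "\<dots> = (\<Sum>v\<in>F. \<Sum>i\<in>UNIV. v $ i * v $ i)"
    unfolding power2_norm_eq_inner by (simp add: inner_vec_def)
  also have "\<dots> = (\<Sum>i\<in>(UNIV :: 'd set). \<Sum>v\<in>F. v $ i * v $ i)" by (rule sum.swap)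
  also have "\<dots> = real CARD('d) * \<sigma>" by (simp add: ij)
  finally have *: "real (card F) * l\<^sup>2 = real CARD('d) * \<sigma>" .
  hence "real (card F) * l\<^sup>2 > 0" using F by simp
  thus "0 < card F" by (simp add: zero_less_mult_iff)
  show "0 < l" by fact
  show "(\<Sum>v\<in>F. v $ i * v $ j) = (if i = j then real (card F) * l\<^sup>2 / real CARD('d) else 0)"
    using * by (simp add: ij)
qed

section \<open>The dilation built from the frame\<close>

lemma Wmax_level_scaled_mem_Wmin_level:
  fixes K :: "(real ^ 'd) set"
  assumes K: "closed K" "convex K"
    and F: "isometric_tight_frame F l"
    and proj: "\<And>v x. v \<in> F \<Longrightarrow> x \<in> K \<Longrightarrow> ((1 / l\<^sup>2) *\<^sub>R outer_self v) *v x \<in> K"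
    and X: "X \<in> Wmax_level n K"
  shows "(\<lambda>i. complex_of_real (1 / real CARD('d)) \<cdot>\<^sub>m X i) \<in> Wmin_level n K"
proof -
  let ?d = "real CARD('d)" and ?N = "real (card F)"
  have Xs: "X \<in> sa_tuples n" using X by (simp add: Wmax_level_def)
  hence Xi: "X i \<in> carrier_mat n n" "mat_adjoint (X i) = X i" for i
    by (auto simp: sa_tuples_def)
  note fr = frame_average[OF F]
  have finF: "finite F" using fr(1) card_ge_0_finite by blast
  define Y where "Y v = lin_comb_mat n v X" for v
  have "\<exists>u d. orthonormal_eigenbasis n (Y v) u d" for v
    unfolding Y_def
    by (rule hermitian_orthonormal_eigenbasis[OF lin_comb_mat_carrier mat_adjoint_lin_comb_mat[OF Xs]])
  then obtain u d where basis: "orthonormal_eigenbasis n (Y v) (u v) (d v)" for v by metis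
  have u: "u v k \<in> carrier_vec n" if "k < n" for v k
    using basis that unfolding orthonormal_eigenbasis_def by blast
  have orth: "u v j \<bullet>c u v k = (if j = k then 1 else 0)" if "j < n" "k < n" for v j k
    using basis that unfolding orthonormal_eigenbasis_def by blast
  have parseval: "x \<bullet>c y = (\<Sum>k<n. (x \<bullet>c u v k) * cnj (y \<bullet>c u v k))"
    if "x \<in> carrier_vec n" "y \<in> carrier_vec n" for v x y
    using basis[of v] that unfolding orthonormal_eigenbasis_def by blast
  have form: "(Y v *\<^sub>v x) \<bullet>c y =
      (\<Sum>k<n. complex_of_real (d v k) * ((x \<bullet>c u v k) * cnj (y \<bullet>c u v k)))"
    if "x \<in> carrier_vec n" "y \<in> carrier_vec n" for v x y
    using basis[of v] that unfolding orthonormal_eigenbasis_def by blast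
  have eig: "(Y v *\<^sub>v u v k) \<bullet>c u v k = complex_of_real (d v k)" if "k < n" for v k
    using that by (simp add: form u orth if_distrib[of cnj] if_distrib[of "\<lambda>a. _ * a"] cong: if_cong)
  \<comment> \<open>The eigenbases of all the \<open>Y v\<close> together form \<open>card F\<close>
    orthonormal bases; dividing by the square root of this number makes their union satisfy the
    Parseval identity.\<close>
  define w where "w = (\<lambda>(v, k). complex_of_real (1 / sqrt ?N) \<cdot>\<^sub>v u v k)"
  define p where "p = (\<lambda>(v, k). (d v k / l\<^sup>2) *\<^sub>R v)"
  have pair: "(x \<bullet>c w (v, k)) * cnj (y \<bullet>c w (v, k)) =
      complex_of_real (1 / ?N) * ((x \<bullet>c u v k) * cnj (y \<bullet>c u v k))"
    if "k < n" "x \<in> carrier_vec n" "y \<in> carrier_vec n" for x y v k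
  proof -
    have "complex_of_real (1 / ?N) = complex_of_real (1 / sqrt ?N) * complex_of_real (1 / sqrt ?N)"
      using fr(1) by (simp flip: of_real_mult)
    thus ?thesis
      using that u[OF that(1), of v]
      by (simp add: w_def conjugate_smult_vec scalar_prod_smult_distrib[of _ n] mult_ac)
  qed
  show ?thesis
  proof (rule Wmin_levelI_finite[where I = "F \<times> {..<n}" and w = w and p = p])
    show "finite (F \<times> {..<n})" using finF by simp
    show "(\<lambda>i. complex_of_real (1 / ?d) \<cdot>\<^sub>m X i) \<in> sa_tuples n"
      unfolding sa_tuples_def
    proof (intro CollectI allI conjI)
      fix i
      show "complex_of_real (1 / ?d) \<cdot>\<^sub>m X i \<in> carrier_mat n n" using Xi by simp
      have "cnj (X i $$ (s, r)) = X i $$ (r, s)" if "r < n" "s < n" for r s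
        using mat_adjoint_index[of r "X i" s] Xi[of i] that by simp
      thus "mat_adjoint (complex_of_real (1 / ?d) \<cdot>\<^sub>m X i) = complex_of_real (1 / ?d) \<cdot>\<^sub>m X i"
        by (intro eq_matI) (use Xi(1)[of i] in auto)
    qed
    show "w k \<in> carrier_vec n" if "k \<in> F \<times> {..<n}" for k
      using that u by (auto simp: w_def)
    show "p k \<in> K" if k: "k \<in> F \<times> {..<n}" for k
    proof -
      obtain v j where vj: "k = (v, j)" "v \<in> F" "j < n" using k by auto
      have "(d v j / l\<^sup>2) *\<^sub>R v \<in> K"
        by (rule scaled_eigenvalue_mem[OF K proj[OF vj(2)] X u[OF vj(3)] _ eig[OF vj(3), unfolded Y_def]])
          (use orth vj in auto)
      thus ?thesis by (simp add: p_def vj)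
    qed
    fix x y :: "complex vec" assume x: "x \<in> carrier_vec n" and y: "y \<in> carrier_vec n"
    have "(\<Sum>k\<in>F \<times> {..<n}. (x \<bullet>c w k) * cnj (y \<bullet>c w k)) =
        (\<Sum>v\<in>F. \<Sum>k<n. complex_of_real (1 / ?N) * ((x \<bullet>c u v k) * cnj (y \<bullet>c u v k)))"
      unfolding sum.cartesian_product by (rule sum.cong) (auto simp: pair x y)
    also have "\<dots> = (\<Sum>v\<in>F. complex_of_real (1 / ?N) * (x \<bullet>c y))"
      unfolding sum_distrib_left[symmetric] parseval[OF x y, symmetric] ..
    also have "\<dots> = x \<bullet>c y" using fr(1) by simp
    finally show "x \<bullet>c y = (\<Sum>k\<in>F \<times> {..<n}. (x \<bullet>c w k) * cnj (y \<bullet>c w k))" by simp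
    fix i
    define B where "B j = (X j *\<^sub>v x) \<bullet>c y" for j
    have "(\<Sum>k\<in>F \<times> {..<n}. complex_of_real (p k $ i) * ((x \<bullet>c w k) * cnj (y \<bullet>c w k))) =
        (\<Sum>v\<in>F. \<Sum>k<n. complex_of_real (v $ i / (?N * l\<^sup>2)) *
          (complex_of_real (d v k) * ((x \<bullet>c u v k) * cnj (y \<bullet>c u v k))))"
      unfolding sum.cartesian_product by (rule sum.cong) (auto simp: pair x y p_def mult_ac)
    also have "\<dots> = (\<Sum>v\<in>F. complex_of_real (v $ i / (?N * l\<^sup>2)) * ((Y v *\<^sub>v x) \<bullet>c y))"
      by (simp only: form[OF x y] sum_distrib_left)
    \<comment> \<open>Expanding \<open>Y v\<close> in the \<open>X j\<close> brings in a second
      coordinate of \<open>v\<close>, so that the frame operator appears after the sums are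
      exchanged.\<close>
    also have "\<dots> = (\<Sum>v\<in>F. \<Sum>j\<in>UNIV. complex_of_real (v $ i * v $ j / (?N * l\<^sup>2)) * B j)"
      unfolding Y_def lin_comb_mat_form[OF Xs x y] B_def by (simp add: sum_distrib_left sum_divide_distrib mult_ac)
    also have "\<dots> = (\<Sum>j\<in>UNIV. \<Sum>v\<in>F. complex_of_real (v $ i * v $ j / (?N * l\<^sup>2)) * B j)"
      by (rule sum.swap)
    also have "\<dots> = (\<Sum>j\<in>UNIV. complex_of_real ((\<Sum>v\<in>F. v $ i * v $ j) / (?N * l\<^sup>2)) * B j)"
      by (simp only: sum_divide_distrib of_real_sum sum_distrib_right)
    \<comment> \<open>Off-diagonal entries vanish, and the diagonal value divided by
      \<open>card F * l\<^sup>2\<close> leaves the reciprocal of the dimension.\<close>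
    also have "\<dots> = (\<Sum>j\<in>UNIV. if i = j then complex_of_real (1 / ?d) * B j else 0)"
      unfolding fr(3) using fr(1,2) by (intro sum.cong) auto
    also have "\<dots> = complex_of_real (1 / ?d) * B i" by simp
    also have "\<dots> = ((complex_of_real (1 / ?d) \<cdot>\<^sub>m X i) *\<^sub>v x) \<bullet>c y"
      using Xi(1)[of i] x y by (simp add: B_def smult_mat_mult_vec[of _ n n] smult_scalar_prod_distrib[of _ n])
    finally show "((complex_of_real (1 / ?d) \<cdot>\<^sub>m X i) *\<^sub>v x) \<bullet>c y =
        (\<Sum>k\<in>F \<times> {..<n}. complex_of_real (p k $ i) * ((x \<bullet>c w k) * cnj (y \<bullet>c w k)))" by simp
  qed
qed

theorem proposition8p1:
  fixes K :: "(real ^ 'd) set" and F :: "(real ^ 'd) set" and l :: real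
  assumes "closed K" and "convex K"
    and "isometric_tight_frame F l"
    and "\<And>v. v \<in> F \<Longrightarrow> (\<lambda>x. ((1 / l\<^sup>2) *\<^sub>R outer_self v) *v x) ` K \<subseteq> K"
  shows "Wmax K \<subseteq> scale_tuples (real CARD('d)) (Wmin K)"
proof
  fix X assume "X \<in> Wmax K"
  then obtain n where n: "n \<ge> 1" "X \<in> Wmax_level n K" unfolding Wmax_def by auto
  let ?X = "\<lambda>i. complex_of_real (1 / real CARD('d)) \<cdot>\<^sub>m X i"
  have "?X \<in> Wmin_level n K"
    by (rule Wmax_level_scaled_mem_Wmin_level[OF assms(1-3) _ n(2)]) (use assms(4) in blast)
  hence "?X \<in> Wmin K" using n(1) unfolding Wmin_def by auto
  \<comment> \<open>The index type is nonempty, so the dimension is a nonzero number and multiplying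
    by it undoes the scaling.\<close>
  moreover have "X = (\<lambda>i. complex_of_real (real CARD('d)) \<cdot>\<^sub>m ?X i)"
    by (intro ext eq_matI) auto
  ultimately show "X \<in> scale_tuples (real CARD('d)) (Wmin K)"
    unfolding scale_tuples_def by (intro image_eqI)
qed

end
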